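(* Let $f:[0,1]\to\mathbb{R}$ be upper semi-continuous with a usco modulus $\Psi:[0,1]\times\mathbb{N}\to\mathbb{R}^{+}$. Then, given $f$ and $\Psi$ as inputs, some real $x\in C_f$ (a point where $f$ is continuous) can be computed by $\exists^{2}$ (in Kleene's S1–S9 sense).
   Context: $\exists^{2}$ is the functional $\varphi:\mathbb{N}^{\mathbb{N}}\to\{0,1\}$ with $\varphi(f)=0\leftrightarrow(\exists n)(f(n)=0)$. A function $f:[0,1]\to\mathbb{R}$ is upper semi-continuous (usco) at $x_0$ if for any $y>f(x_0)$ there is $N$ with $f(z)<y$ for all $z\in B(x_0,2^{-N})$; usco means usco everywhere. A usco modulus for $f$ is a function $\Psi$ such that for all $x\in[0,1]$, all $k\in\mathbb{N}$ and all $y\in B(x,\Psi(x,k))$ we have $f(y)<f(x)+2^{-k}$. *)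

theory Defs
  imports "HOL-Analysis.Analysis" "HOL-Library.Nat_Bijection"
begin

definition arity_code :: "nat list \<Rightarrow> (nat \<Rightarrow> nat) list \<Rightarrow> ((nat \<Rightarrow> nat) \<Rightarrow> nat) list \<Rightarrow> nat" where
  "arity_code xs fs Fs = list_encode [length xs, length fs, length Fs]"

definition to_front :: "nat \<Rightarrow> 'a list \<Rightarrow> 'a list" where
  "to_front k xs = xs ! k # take k xs @ drop (Suc k) xs"

text \<open>
  Kleene's schemata S1--S9 for arguments of types 0, 1 and 2: \<open>kleene e xs fs Fs v\<close> means
  \<open>{e}(xs, fs, Fs) = v\<close>. As in Kleene's original presentation, the arguments of each type
  are kept in a separate list, and an index is the code of a sequence consisting of the number
  of the schema, the arity, and the parameters of the schema.
  In S8 an argument of type \<open>j \<ge> 2\<close> is applied to a function of an argument of type \<open>j - 2\<close>,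
  so a computation from arguments of types at most 2 only has subcomputations of this kind, and
  the schemata below are the full S1--S9 for such arguments. The premise of S8 requires
  convergence for all \<open>n\<close>.
\<close>

inductive kleene ::
  "nat \<Rightarrow> nat list \<Rightarrow> (nat \<Rightarrow> nat) list \<Rightarrow> ((nat \<Rightarrow> nat) \<Rightarrow> nat) list \<Rightarrow> nat \<Rightarrow> bool" where
  S1: "kleene (list_encode [1, arity_code (x # xs) fs Fs]) (x # xs) fs Fs (Suc x)"
| S2: "kleene (list_encode [2, arity_code xs fs Fs, q]) xs fs Fs q"
| S3: "kleene (list_encode [3, arity_code (x # xs) fs Fs]) (x # xs) fs Fs x"
| S4: "kleene h xs fs Fs u \<Longrightarrow> kleene g (u # xs) fs Fs v \<Longrightarrow>
       kleene (list_encode [4, arity_code xs fs Fs, g, h]) xs fs Fs v"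
| S5_0: "kleene g xs fs Fs v \<Longrightarrow>
       kleene (list_encode [5, arity_code (0 # xs) fs Fs, g, h]) (0 # xs) fs Fs v"
| S5_Suc: "kleene (list_encode [5, arity_code (x # xs) fs Fs, g, h]) (x # xs) fs Fs u \<Longrightarrow>
       kleene h (x # u # xs) fs Fs v \<Longrightarrow>
       kleene (list_encode [5, arity_code (Suc x # xs) fs Fs, g, h]) (Suc x # xs) fs Fs v"
| S6_0: "k < length xs \<Longrightarrow> kleene g (to_front k xs) fs Fs v \<Longrightarrow>
       kleene (list_encode [6, arity_code xs fs Fs, 0, k, g]) xs fs Fs v"
| S6_1: "k < length fs \<Longrightarrow> kleene g xs (to_front k fs) Fs v \<Longrightarrow>
       kleene (list_encode [6, arity_code xs fs Fs, 1, k, g]) xs fs Fs v"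
| S6_2: "k < length Fs \<Longrightarrow> kleene g xs fs (to_front k Fs) v \<Longrightarrow>
       kleene (list_encode [6, arity_code xs fs Fs, 2, k, g]) xs fs Fs v"
| S7: "kleene (list_encode [7, arity_code (x # xs) (f # fs) Fs]) (x # xs) (f # fs) Fs (f x)"
| S8: "(\<And>n. kleene h (n # xs) fs (F # Fs) (\<phi> n)) \<Longrightarrow>
       kleene (list_encode [8, arity_code xs fs (F # Fs), 2, h]) xs fs (F # Fs) (F \<phi>)"
| S9: "kleene e xs fs Fs v \<Longrightarrow>
       kleene (list_encode [9, arity_code (e # xs @ xs') (fs @ fs') (Fs @ Fs'), arity_code xs fs Fs])
         (e # xs @ xs') (fs @ fs') (Fs @ Fs') v"

definition exists2 :: "(nat \<Rightarrow> nat) \<Rightarrow> nat" where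
  "exists2 f = (if \<exists>n. f n = 0 then 0 else 1)"

definition rat_code :: "nat \<Rightarrow> real" where
  "rat_code n = (case prod_decode n of (a, b) \<Rightarrow> real_of_int (int_decode a) / real (Suc b))"

text \<open>A real number is given by a fast converging Cauchy sequence of (codes of) rationals.\<close>

definition represents_real :: "(nat \<Rightarrow> nat) \<Rightarrow> real \<Rightarrow> bool" where
  "represents_real \<alpha> x \<longleftrightarrow>
     (\<forall>n i. \<bar>rat_code (\<alpha> n) - rat_code (\<alpha> (n + i))\<bar> < (1/2) ^ n) \<and>
     (\<lambda>n. rat_code (\<alpha> n)) \<longlonglongrightarrow> x"

text \<open>
  A functional of type \<open>1 \<rightarrow> 1\<close> sending representations of \<open>x\<close> to representations of \<open>f x\<close>,
  as a functional of pure type 2: the number argument is prepended to the function argument,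
  \<open>case_nat n \<alpha>\<close> being the sequence \<open>n, \<alpha> 0, \<alpha> 1, \<dots>\<close>.
\<close>

definition represents_fun :: "((nat \<Rightarrow> nat) \<Rightarrow> nat) \<Rightarrow> (real \<Rightarrow> real) \<Rightarrow> bool" where
  "represents_fun F f \<longleftrightarrow>
     (\<forall>x\<in>{0..1}. \<forall>\<alpha>. represents_real \<alpha> x \<longrightarrow> represents_real (\<lambda>n. F (case_nat n \<alpha>)) (f x))"

definition represents_fun_nat :: "((nat \<Rightarrow> nat) \<Rightarrow> nat) \<Rightarrow> (real \<Rightarrow> nat \<Rightarrow> real) \<Rightarrow> bool" where
  "represents_fun_nat G \<Psi> \<longleftrightarrow>
     (\<forall>x\<in>{0..1}. \<forall>k \<alpha>. represents_real \<alpha> x \<longrightarrow>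
        represents_real (\<lambda>n. G (case_nat k (case_nat n \<alpha>))) (\<Psi> x k))"

definition computes_real :: "nat \<Rightarrow> ((nat \<Rightarrow> nat) \<Rightarrow> nat) list \<Rightarrow> real \<Rightarrow> bool" where
  "computes_real e Fs x \<longleftrightarrow> (\<exists>\<alpha>. (\<forall>n. kleene e [n] [] Fs (\<alpha> n)) \<and> represents_real \<alpha> x)"

definition usco_at :: "(real \<Rightarrow> real) \<Rightarrow> real \<Rightarrow> bool" where
  "usco_at f x0 \<longleftrightarrow>
     (\<forall>y>f x0. \<exists>N::nat. \<forall>z \<in> ball x0 ((1/2) ^ N) \<inter> {0..1}. f z < y)"

definition usco :: "(real \<Rightarrow> real) \<Rightarrow> bool" where
  "usco f \<longleftrightarrow> (\<forall>x\<in>{0..1}. usco_at f x)"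

definition usco_modulus :: "(real \<Rightarrow> real) \<Rightarrow> (real \<Rightarrow> nat \<Rightarrow> real) \<Rightarrow> bool" where
  "usco_modulus f \<Psi> \<longleftrightarrow>
     (\<forall>x\<in>{0..1}. \<forall>k. \<Psi> x k > 0 \<and>
        (\<forall>y \<in> ball x (\<Psi> x k) \<inter> {0..1}. f y < f x + (1/2) ^ k))"

definition continuity_points :: "(real \<Rightarrow> real) \<Rightarrow> real set" where
  "continuity_points f = {x\<in>{0..1}. continuous (at x within {0..1}) f}"

end

theory Submission
  imports Defs
begin

text \<open>
  A point of continuity is the limit of nested dyadic intervals. Inside a given interval, Baire's
  theorem yields a subinterval on which the upper semi-continuous function \<open>f\<close> is bounded below.
  Choose there a dyadic \<open>q\<close> whose value is within \<open>(1/2) ^ k\<close> of the infimum of \<open>f\<close> over the dyadic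
  points; the next interval is centred at \<open>q\<close> with radius below \<open>\<Psi> q k\<close>. On it the modulus
  bounds \<open>f\<close> from above, while upper semi-continuity transfers the lower bound from the dyadic
  points to all points, so \<open>f\<close> varies by at most \<open>2 * (1/2) ^ k\<close>.

  Whether an interval is an admissible successor of another is an arithmetical statement about the
  values of \<open>f\<close> and \<open>\<Psi>\<close> at dyadic points, hence decidable by \<open>exists2\<close>. Comparing the reals exactly
  makes the admissible successor of least code, and so the limit, independent of the functionals
  representing \<open>f\<close> and \<open>\<Psi>\<close>. The schema S9 is not needed.
\<close>

section \<open>Closure properties of computability in two functionals and \<open>exists2\<close>\<close>

text \<open>The number list is an environment of de Bruijn variables whose head is the variable
  bound last. A single index serves all \<open>F\<close> and \<open>G\<close> and converges on every
  environment of length \<open>n\<close>, so computable arguments always meet the totality premise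
  of S8.\<close>

definition computable ::
  "nat \<Rightarrow> (((nat \<Rightarrow> nat) \<Rightarrow> nat) \<Rightarrow> ((nat \<Rightarrow> nat) \<Rightarrow> nat) \<Rightarrow> nat list \<Rightarrow> nat) \<Rightarrow> bool" where
  "computable n \<Phi> \<longleftrightarrow>
     (\<exists>e. \<forall>F G xs. length xs = n \<longrightarrow> kleene e xs [] [F, G, exists2] (\<Phi> F G xs))"

lemma computableI:
  assumes "\<And>F G xs. length xs = n \<Longrightarrow> kleene e xs [] [F, G, exists2] (\<Phi> F G xs)"
  shows "computable n \<Phi>"
  using assms unfolding computable_def by blast

lemma computableE:
  assumes "computable n \<Phi>"
  obtains e where "\<And>F G xs. length xs = n \<Longrightarrow> kleene e xs [] [F, G, exists2] (\<Phi> F G xs)"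
  using assms unfolding computable_def by blast

lemma computable_cong:
  assumes "computable n \<Phi>" "\<And>F G xs. length xs = n \<Longrightarrow> \<Phi> F G xs = \<Psi> F G xs"
  shows "computable n \<Psi>"
  using assms unfolding computable_def by metis

lemma arity_code_length:
  "arity_code xs [] [F, G, H] = list_encode [length xs, 0, 3]"
  by (simp add: arity_code_def)

lemma computable_const: "computable n (\<lambda>F G xs. c)"
proof (rule computableI)
  fix F G :: "(nat \<Rightarrow> nat) \<Rightarrow> nat" and xs :: "nat list"
  assume "length xs = n"
  then show "kleene (list_encode [2, list_encode [n, 0, 3], c]) xs [] [F, G, exists2] c"
    using S2[of xs "[]" "[F, G, exists2]" c] by (simp add: arity_code_length)
qed

lemma computable_hd: "computable (Suc n) (\<lambda>F G xs. hd xs)"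
proof (rule computableI)
  fix F G :: "(nat \<Rightarrow> nat) \<Rightarrow> nat" and xs :: "nat list"
  assume len: "length xs = Suc n"
  then obtain y ys where "xs = y # ys" by (cases xs) auto
  with len show "kleene (list_encode [3, list_encode [Suc n, 0, 3]]) xs [] [F, G, exists2] (hd xs)"
    using S3[of y ys "[]" "[F, G, exists2]"] by (simp add: arity_code_length)
qed

lemma computable_Let:
  assumes "computable n a" "computable (Suc n) g"
  shows "computable n (\<lambda>F G xs. g F G (a F G xs # xs))"
proof -
  obtain ea where ea: "\<And>F G xs. length xs = n \<Longrightarrow> kleene ea xs [] [F, G, exists2] (a F G xs)"
    using assms(1) by (rule computableE) blast
  obtain eg where eg: "\<And>F G xs. length xs = Suc n \<Longrightarrow> kleene eg xs [] [F, G, exists2] (g F G xs)"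
    using assms(2) by (rule computableE) blast
  show ?thesis
  proof (rule computableI)
    fix F G :: "(nat \<Rightarrow> nat) \<Rightarrow> nat" and xs :: "nat list"
    assume len: "length xs = n"
    have "kleene eg (a F G xs # xs) [] [F, G, exists2] (g F G (a F G xs # xs))"
      using len by (intro eg) simp
    from S4[OF ea[OF len] this] len
    show "kleene (list_encode [4, list_encode [n, 0, 3], eg, ea]) xs [] [F, G, exists2]
            (g F G (a F G xs # xs))"
      by (simp add: arity_code_length)
  qed
qed

lemma computable_Suc:
  assumes "computable n a"
  shows "computable n (\<lambda>F G xs. Suc (a F G xs))"
proof -
  have "computable (Suc n) (\<lambda>F G xs. Suc (hd xs))"
  proof (rule computableI)
    fix F G :: "(nat \<Rightarrow> nat) \<Rightarrow> nat" and xs :: "nat list"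
    assume len: "length xs = Suc n"
    then obtain y ys where "xs = y # ys" by (cases xs) auto
    with len show "kleene (list_encode [1, list_encode [Suc n, 0, 3]]) xs [] [F, G, exists2]
        (Suc (hd xs))"
      using S1[of y ys "[]" "[F, G, exists2]"] by (simp add: arity_code_length)
  qed
  from computable_Let[OF assms this] show ?thesis by simp
qed

text \<open>The S5 index depends on the length of the environment but not on the recursion variable,
  so induction on that variable builds the computation.\<close>

lemma computable_primrec:
  assumes "computable n g" "computable (Suc (Suc n)) h"
  shows "computable (Suc n) (\<lambda>F G xs. rec_nat (g F G (tl xs)) (\<lambda>x u. h F G (x # u # tl xs)) (hd xs))"
proof -
  obtain eg where eg: "\<And>F G xs. length xs = n \<Longrightarrow> kleene eg xs [] [F, G, exists2] (g F G xs)"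
    using assms(1) by (rule computableE) blast
  obtain eh where eh:
    "\<And>F G xs. length xs = Suc (Suc n) \<Longrightarrow> kleene eh xs [] [F, G, exists2] (h F G xs)"
    using assms(2) by (rule computableE) blast
  let ?e = "list_encode [5, list_encode [Suc n, 0, 3], eg, eh]"
  have *: "kleene ?e (x # ys) [] [F, G, exists2] (rec_nat (g F G ys) (\<lambda>x u. h F G (x # u # ys)) x)"
    if len: "length ys = n" for F G x ys
  proof (induction x)
    case 0
    show ?case
      using S5_0[OF eg[OF len], where h = eh] len by (simp add: arity_code_length)
  next
    case (Suc x)
    let ?u = "rec_nat (g F G ys) (\<lambda>x u. h F G (x # u # ys)) x"
    have "kleene eh (x # ?u # ys) [] [F, G, exists2] (h F G (x # ?u # ys))"
      using len by (intro eh) simp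
    with S5_Suc[of x ys "[]" "[F, G, exists2]" eg eh ?u "h F G (x # ?u # ys)"] Suc len
    show ?case by (simp add: arity_code_length)
  qed
  show ?thesis
  proof (rule computableI)
    fix F G :: "(nat \<Rightarrow> nat) \<Rightarrow> nat" and xs :: "nat list"
    assume "length xs = Suc n"
    then show "kleene ?e xs [] [F, G, exists2]
        (rec_nat (g F G (tl xs)) (\<lambda>x u. h F G (x # u # tl xs)) (hd xs))"
      using *[where ys = "tl xs" and x = "hd xs" and F = F and G = G] by (cases xs) simp_all
  qed
qed

text \<open>A variable is dropped by a recursion on it whose step returns the previous value.\<close>

lemma computable_tl:
  assumes "computable n \<Phi>"
  shows "computable (Suc n) (\<lambda>F G xs. \<Phi> F G (tl xs))"
proof -
  let ?p = "list_encode [3, list_encode [Suc (Suc n), 0, 3]]"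
  have "computable (Suc (Suc n)) (\<lambda>F G xs. xs ! 1)"
  proof (rule computableI)
    fix F G :: "(nat \<Rightarrow> nat) \<Rightarrow> nat" and xs :: "nat list"
    assume len: "length xs = Suc (Suc n)"
    then obtain x y ys where "xs = x # y # ys"
      by (metis length_Suc_conv)
    then show "kleene (list_encode [6, list_encode [Suc (Suc n), 0, 3], 0, 1, ?p]) xs []
        [F, G, exists2] (xs ! 1)"
      using S3[of y "x # ys" "[]" "[F, G, exists2]"] len
        S6_0[of 1 xs ?p "[]" "[F, G, exists2]" y]
      by (simp add: arity_code_length to_front_def)
  qed
  from computable_primrec[OF assms this] show ?thesis
  proof (rule computable_cong)
    fix F G :: "(nat \<Rightarrow> nat) \<Rightarrow> nat" and xs :: "nat list"
    have "rec_nat c (\<lambda>x u. (x # u # tl xs) ! 1) k = c" for c k :: nat by (induction k) auto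
    then show "rec_nat (\<Phi> F G (tl xs)) (\<lambda>x u. (x # u # tl xs) ! 1) (hd xs) = \<Phi> F G (tl xs)" .
  qed
qed

text \<open>Shaped for backward chaining: inside the step the head is the counter, the next entry is
  the previous value, and two tails recover the outer environment.\<close>

lemma computable_rec_nat:
  assumes "computable n a" "computable n g"
    and "computable (Suc (Suc n)) (\<lambda>F G xs. h F G (tl (tl xs)) (hd xs) (hd (tl xs)))"
  shows "computable n (\<lambda>F G xs. rec_nat (g F G xs) (h F G xs) (a F G xs))"
  using computable_Let[OF assms(1) computable_primrec[OF assms(2,3)]] by simp

lemma computable_apply_fst:
  assumes "computable (Suc n) (\<lambda>F G xs. q F G (tl xs) (hd xs))"
  shows "computable n (\<lambda>F G xs. F (q F G xs))"
proof -
  obtain e where e: "\<And>F G xs. length xs = Suc n \<Longrightarrow>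
      kleene e xs [] [F, G, exists2] (q F G (tl xs) (hd xs))"
    using assms by (rule computableE) blast
  show ?thesis
  proof (rule computableI)
    fix F G :: "(nat \<Rightarrow> nat) \<Rightarrow> nat" and xs :: "nat list"
    assume len: "length xs = n"
    have "kleene e (m # xs) [] [F, G, exists2] (q F G xs m)" for m
      using e[of "m # xs" F G] len by simp
    from S8[OF this] len
    show "kleene (list_encode [8, list_encode [n, 0, 3], 2, e]) xs [] [F, G, exists2] (F (q F G xs))"
      by (simp add: arity_code_length)
  qed
qed

lemma kleene_to_front:
  assumes "kleene e xs [] (to_front k [F, G, H]) v" "k < 3" "length xs = n"
  shows "kleene (list_encode [6, list_encode [n, 0, 3], 2, k, e]) xs [] [F, G, H] v"
  using S6_2[of k "[F, G, H]" e xs "[]" v] assms by (simp add: arity_code_length)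

text \<open>S8 applies only the first functional of the list, so S6 moves \<open>G\<close> there.
  The index of the argument expects the original order, which a second exchange inside S8
  restores.\<close>

lemma computable_apply_snd:
  assumes "computable (Suc n) (\<lambda>F G xs. q F G (tl xs) (hd xs))"
  shows "computable n (\<lambda>F G xs. G (q F G xs))"
proof -
  obtain e where e: "\<And>F G xs. length xs = Suc n \<Longrightarrow>
      kleene e xs [] [F, G, exists2] (q F G (tl xs) (hd xs))"
    using assms by (rule computableE) blast
  let ?e1 = "list_encode [6, list_encode [Suc n, 0, 3], 2, 1, e]"
  let ?e2 = "list_encode [8, list_encode [n, 0, 3], 2, ?e1]"
  show ?thesis
  proof (rule computableI)
    fix F G :: "(nat \<Rightarrow> nat) \<Rightarrow> nat" and xs :: "nat list"
    assume len: "length xs = n"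
    have "kleene ?e1 (m # xs) [] [G, F, exists2] (q F G xs m)" for m
      using e[of "m # xs" F G] len by (intro kleene_to_front) (auto simp: to_front_def)
    from S8[OF this] len
    have "kleene ?e2 xs [] [G, F, exists2] (G (q F G xs))"
      by (simp add: arity_code_length)
    then show "kleene (list_encode [6, list_encode [n, 0, 3], 2, 1, ?e2]) xs [] [F, G, exists2]
        (G (q F G xs))"
      using len by (intro kleene_to_front) (auto simp: to_front_def)
  qed
qed

text \<open>S6 at position 2 rotates the three functionals. One rotation brings
  \<open>exists2\<close> to the front; two more, inside the argument of S8, restore the
  order.\<close>

lemma computable_exists2:
  assumes "computable (Suc n) (\<lambda>F G xs. q F G (tl xs) (hd xs))"
  shows "computable n (\<lambda>F G xs. exists2 (q F G xs))"
proof -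
  obtain e where e: "\<And>F G xs. length xs = Suc n \<Longrightarrow>
      kleene e xs [] [F, G, exists2] (q F G (tl xs) (hd xs))"
    using assms by (rule computableE) blast
  let ?e1 = "list_encode [6, list_encode [Suc n, 0, 3], 2, 2, e]"
  let ?e2 = "list_encode [6, list_encode [Suc n, 0, 3], 2, 2, ?e1]"
  let ?e3 = "list_encode [8, list_encode [n, 0, 3], 2, ?e2]"
  show ?thesis
  proof (rule computableI)
    fix F G :: "(nat \<Rightarrow> nat) \<Rightarrow> nat" and xs :: "nat list"
    assume len: "length xs = n"
    have "kleene ?e1 (m # xs) [] [G, exists2, F] (q F G xs m)" for m
      using e[of "m # xs" F G] len by (intro kleene_to_front) (auto simp: to_front_def)
    then have "kleene ?e2 (m # xs) [] [exists2, F, G] (q F G xs m)" for m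
      using len by (intro kleene_to_front) (auto simp: to_front_def)
    from S8[OF this] len
    have "kleene ?e3 xs [] [exists2, F, G] (exists2 (q F G xs))"
      by (simp add: arity_code_length)
    then show "kleene (list_encode [6, list_encode [n, 0, 3], 2, 2, ?e3]) xs [] [F, G, exists2]
        (exists2 (q F G xs))"
      using len by (intro kleene_to_front) (auto simp: to_front_def)
  qed
qed

section \<open>Primitive recursive arithmetic\<close>

lemmas computable_basic = computable_const computable_hd computable_Suc computable_tl

lemma computable_pred:
  assumes "computable n a"
  shows "computable n (\<lambda>F G xs. a F G xs - 1)"
proof -
  have *: "rec_nat 0 (\<lambda>x _. x) k = k - 1" for k :: nat by (cases k) auto
  have "computable n (\<lambda>F G xs. rec_nat 0 (\<lambda>x _. x) (a F G xs))"
    by (intro computable_rec_nat assms computable_basic)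
  then show ?thesis by (simp only: *)
qed

lemma computable_add:
  assumes "computable n a" "computable n b"
  shows "computable n (\<lambda>F G xs. a F G xs + b F G xs)"
proof -
  have *: "rec_nat j (\<lambda>_ u. Suc u) k = j + k" for j k :: nat by (induction k) auto
  have "computable n (\<lambda>F G xs. rec_nat (a F G xs) (\<lambda>_ u. Suc u) (b F G xs))"
    by (intro computable_rec_nat assms computable_basic)
  then show ?thesis by (simp only: *)
qed

lemma computable_mult:
  assumes "computable n a" "computable n b"
  shows "computable n (\<lambda>F G xs. a F G xs * b F G xs)"
proof -
  have *: "rec_nat 0 (\<lambda>_ u. u + j) k = j * k" for j k :: nat by (induction k) auto
  have "computable n (\<lambda>F G xs. rec_nat 0 (\<lambda>_ u. u + a F G xs) (b F G xs))"
    by (intro computable_rec_nat computable_add assms computable_basic)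
  then show ?thesis by (simp only: *)
qed

lemma computable_diff:
  assumes "computable n a" "computable n b"
  shows "computable n (\<lambda>F G xs. a F G xs - b F G xs)"
proof -
  have *: "rec_nat j (\<lambda>_ u. u - 1) k = j - k" for j k :: nat by (induction k) auto
  have "computable n (\<lambda>F G xs. rec_nat (a F G xs) (\<lambda>_ u. u - 1) (b F G xs))"
    by (intro computable_rec_nat computable_pred assms computable_basic)
  then show ?thesis by (simp only: *)
qed

lemma computable_power2:
  assumes "computable n a"
  shows "computable n (\<lambda>F G xs. 2 ^ a F G xs)"
proof -
  have *: "rec_nat 1 (\<lambda>_ u. u + u) k = (2::nat) ^ k" for k :: nat by (induction k) auto
  have "computable n (\<lambda>F G xs. rec_nat 1 (\<lambda>_ u. u + u) (a F G xs))"
    by (intro computable_rec_nat computable_add assms computable_basic)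
  then show ?thesis by (simp only: *)
qed

lemma computable_prod_encode:
  assumes "computable n a" "computable n b"
  shows "computable n (\<lambda>F G xs. prod_encode (a F G xs, b F G xs))"
proof -
  have *: "rec_nat 0 (\<lambda>i u. u + Suc i) k = triangle k" for k by (induction k) auto
  have "computable n (\<lambda>F G xs. rec_nat 0 (\<lambda>i u. u + Suc i) (a F G xs + b F G xs) + a F G xs)"
    by (intro computable_rec_nat computable_add assms computable_basic)
  then show ?thesis by (simp only: * prod_encode_def prod.case)
qed

section \<open>Arithmetical relations\<close>

definition decidable ::
  "nat \<Rightarrow> (((nat \<Rightarrow> nat) \<Rightarrow> nat) \<Rightarrow> ((nat \<Rightarrow> nat) \<Rightarrow> nat) \<Rightarrow> nat list \<Rightarrow> bool) \<Rightarrow> bool" where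
  "decidable n P \<longleftrightarrow> computable n (\<lambda>F G xs. if P F G xs then 0 else 1)"

lemma computable_If:
  assumes "decidable n P" "computable n a" "computable n b"
  shows "computable n (\<lambda>F G xs. if P F G xs then a F G xs else b F G xs)"
proof -
  have "computable n (\<lambda>F G xs. rec_nat (a F G xs) (\<lambda>_ _. b F G xs) (if P F G xs then 0 else 1))"
    using assms unfolding decidable_def by (intro computable_rec_nat computable_basic)
  then show ?thesis by (rule computable_cong) simp
qed

lemma decidable_eq_0:
  assumes "computable n a"
  shows "decidable n (\<lambda>F G xs. a F G xs = 0)"
proof -
  have *: "rec_nat 0 (\<lambda>_ _. 1) k = (if k = 0 then 0 else (1::nat))" for k :: nat
    by (cases k) auto
  have "computable n (\<lambda>F G xs. rec_nat 0 (\<lambda>_ _. 1) (a F G xs))"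
    by (intro computable_rec_nat assms computable_basic)
  then show ?thesis unfolding decidable_def by (simp only: *)
qed

lemma decidable_le:
  assumes "computable n a" "computable n b"
  shows "decidable n (\<lambda>F G xs. a F G xs \<le> b F G xs)"
  using decidable_eq_0[OF computable_diff[OF assms]] by simp

lemma decidable_not:
  assumes "decidable n P"
  shows "decidable n (\<lambda>F G xs. \<not> P F G xs)"
  unfolding decidable_def using computable_If[OF assms computable_const computable_const, of 1 0]
  by (rule computable_cong) simp

lemma decidable_conj:
  assumes "decidable n P" "decidable n Q"
  shows "decidable n (\<lambda>F G xs. P F G xs \<and> Q F G xs)"
  unfolding decidable_def
  using computable_If[OF assms(1) assms(2)[unfolded decidable_def] computable_const, of 1]
  by (rule computable_cong) simp

lemma decidable_disj:
  assumes "decidable n P" "decidable n Q"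
  shows "decidable n (\<lambda>F G xs. P F G xs \<or> Q F G xs)"
  using decidable_not[OF decidable_conj[OF assms[THEN decidable_not]]] by simp

lemma decidable_imp:
  assumes "decidable n P" "decidable n Q"
  shows "decidable n (\<lambda>F G xs. P F G xs \<longrightarrow> Q F G xs)"
  using decidable_disj[OF decidable_not[OF assms(1)] assms(2)] by (simp only: imp_conv_disj)

lemma decidable_less:
  assumes "computable n a" "computable n b"
  shows "decidable n (\<lambda>F G xs. a F G xs < b F G xs)"
  using decidable_not[OF decidable_le[OF assms(2,1)]] by (simp add: not_le)

lemma decidable_eq:
  assumes "computable n a" "computable n b"
  shows "decidable n (\<lambda>F G xs. a F G xs = b F G xs)"
  using decidable_conj[OF decidable_le[OF assms] decidable_le[OF assms(2,1)]]
  by (simp only: order_eq_iff[symmetric])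

text \<open>Coding truth by 0 matches \<open>exists2\<close>, which returns 0 exactly when its
  argument has a zero.\<close>

lemma decidable_ex:
  assumes "decidable (Suc n) (\<lambda>F G xs. P F G (tl xs) (hd xs))"
  shows "decidable n (\<lambda>F G xs. \<exists>m. P F G xs m)"
proof -
  have "computable n (\<lambda>F G xs. exists2 (\<lambda>m. if P F G xs m then 0 else 1))"
    using assms unfolding decidable_def by (rule computable_exists2)
  then show ?thesis
    unfolding decidable_def by (rule computable_cong) (auto simp: exists2_def)
qed

lemma decidable_all:
  assumes "decidable (Suc n) (\<lambda>F G xs. P F G (tl xs) (hd xs))"
  shows "decidable n (\<lambda>F G xs. \<forall>m. P F G xs m)"
  using decidable_not[OF decidable_ex[OF decidable_not[OF assms]]] by simp

lemma computable_case_nat: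
  assumes "computable n a" "computable n b"
    and "computable (Suc (Suc n)) (\<lambda>F G xs. h F G (tl (tl xs)) (hd xs))"
  shows "computable n (\<lambda>F G xs. case_nat (a F G xs) (h F G xs) (b F G xs))"
proof -
  have *: "rec_nat c (\<lambda>x _. g x) k = case_nat c g k" for c :: nat and g and k
    by (cases k) auto
  have "computable n (\<lambda>F G xs. rec_nat (a F G xs) (\<lambda>x _. h F G xs x) (b F G xs))"
    by (intro computable_rec_nat assms)
  then show ?thesis by (simp only: *)
qed

lemmas computable_intros =
  computable_const computable_hd computable_Suc computable_tl computable_add computable_mult
  computable_diff computable_power2 computable_prod_encode computable_If computable_case_nat
  computable_rec_nat computable_apply_fst computable_apply_snd
  decidable_eq decidable_le decidable_less decidable_not decidable_conj decidable_disj decidable_imp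
  decidable_ex decidable_all

section \<open>Comparison of coded rationals\<close>

definition splits_rat :: "nat \<Rightarrow> nat \<Rightarrow> nat \<Rightarrow> nat \<Rightarrow> bool" where
  "splits_rat c p n b \<longleftrightarrow>
     (n = 0 \<and> c = prod_encode (2 * p, b)) \<or> (p = 0 \<and> 0 < n \<and> c = prod_encode (2 * n - 1, b))"

text \<open>\<open>int_decode\<close> sends the even number \<open>2 * p\<close> to \<open>p\<close>
  and the odd number \<open>2 * n - 1\<close> to \<open>- n\<close>.\<close>

lemma rat_code_splits: "splits_rat c p n b \<Longrightarrow> rat_code c = (real p - real n) / real (Suc b)"
  unfolding splits_rat_def rat_code_def
  by (cases n) (auto simp: int_decode_def sum_decode_def)

lemma splits_rat_exists: "\<exists>p n b. splits_rat c p n b"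
proof -
  obtain a b where ab: "prod_decode c = (a, b)" by (cases "prod_decode c")
  then have c: "c = prod_encode (a, b)" by (metis prod_decode_inverse)
  show ?thesis
  proof (cases "even a")
    case True
    then have "splits_rat c (a div 2) 0 b" by (simp add: splits_rat_def c)
    then show ?thesis by blast
  next
    case False
    then have "a = 2 * Suc (a div 2) - 1" by presburger
    then have "splits_rat c 0 (Suc (a div 2)) b" by (simp add: splits_rat_def c)
    then show ?thesis by blast
  qed
qed

text \<open>Multiplying by \<open>b * b' * t\<close> and moving the negative terms across leaves a
  comparison of natural numbers without subtraction.\<close>

lemma frac_le_iff:
  fixes p n p' n' s b b' t :: nat
  assumes "0 < b" "0 < b'" "0 < t"
  shows "(real p - real n) / real b \<le> (real p' - real n') / real b' + real s / real t \<longleftrightarrow>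
     p * b' * t + n' * b * t \<le> p' * b * t + n * b' * t + s * b * b'" (is "?l \<longleftrightarrow> ?r")
proof -
  have "?r \<longleftrightarrow> real (p * b' * t + n' * b * t) \<le> real (p' * b * t + n * b' * t + s * b * b')"
    by (simp only: of_nat_le_iff)
  also have "\<dots> \<longleftrightarrow> (real p - real n) * (real b' * real t) \<le>
      ((real p' - real n') * real t + real s * real b') * real b"
    by (simp add: algebra_simps)
  also have "\<dots> \<longleftrightarrow> ?l"
    using assms by (simp add: field_simps)
  finally show ?thesis by simp
qed

text \<open>Decoding is replaced by existential quantifiers, so that only \<open>prod_encode\<close>
  has to be computed. The inequality depends on the rationals alone, hence any decomposition of the
  two codes decides it.\<close>

lemma rat_code_le_iff:
  assumes "0 < t"
  shows "rat_code c \<le> rat_code d + real s / real t \<longleftrightarrow>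
    (\<exists>p n b p' n' b'. splits_rat c p n b \<and> splits_rat d p' n' b' \<and>
       p * Suc b' * t + n' * Suc b * t \<le> p' * Suc b * t + n * Suc b' * t + s * Suc b * Suc b')"
  using splits_rat_exists[of c] splits_rat_exists[of d] rat_code_splits[of c] rat_code_splits[of d]
    frac_le_iff[OF zero_less_Suc zero_less_Suc assms]
  by metis

lemma decidable_splits_rat:
  assumes "computable k c" "computable k p" "computable k n" "computable k b"
  shows "decidable k (\<lambda>F G xs. splits_rat (c F G xs) (p F G xs) (n F G xs) (b F G xs))"
  unfolding splits_rat_def by (intro computable_intros assms)

lemma decidable_rat_code_le:
  assumes "computable k c" "computable k d" "computable k s" "computable k t"
  shows "decidable k (\<lambda>F G xs. rat_code (c F G xs) \<le>
           rat_code (d F G xs) + real (s F G xs) / real (2 ^ t F G xs))"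
  unfolding rat_code_le_iff[OF zero_less_power[OF zero_less_numeral]]
  by (intro computable_intros decidable_splits_rat assms)

section \<open>Bounded search and paths of least choices\<close>

definition bounded_search :: "(nat \<Rightarrow> bool) \<Rightarrow> nat \<Rightarrow> nat" where
  "bounded_search P N = rec_nat 0 (\<lambda>n u. if u = 0 then (if P n then Suc n else 0) else u) N"

text \<open>The shift by one leaves 0 free for failure. The first witness met is kept in all later
  rounds, so a successful search returns the least witness whatever the bound.\<close>

lemma bounded_search_eq:
  "bounded_search P N = (if \<exists>n<N. P n then Suc (LEAST n. P n) else 0)"
proof (induction N)
  case 0
  then show ?case by (simp add: bounded_search_def)
next
  case (Suc N)
  have "(LEAST n. P n) = N" if "P N" "\<not> (\<exists>n<N. P n)"
    using that by (intro Least_equality) (auto simp: not_less[symmetric])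
  moreover have "bounded_search P (Suc N) =
      (if bounded_search P N = 0 then (if P N then Suc N else 0) else bounded_search P N)"
    by (simp add: bounded_search_def)
  ultimately show ?case using Suc by (auto simp: less_Suc_eq)
qed

lemma computable_bounded_search:
  assumes "decidable (Suc (Suc k)) (\<lambda>F G xs. P F G (tl (tl xs)) (hd xs))" "computable k a"
  shows "computable k (\<lambda>F G xs. bounded_search (P F G xs) (a F G xs))"
  unfolding bounded_search_def by (intro computable_intros assms)

primrec least_path :: "(nat \<Rightarrow> nat \<Rightarrow> nat \<Rightarrow> bool) \<Rightarrow> nat \<Rightarrow> nat \<Rightarrow> nat" where
  "least_path R c 0 = c"
| "least_path R c (Suc k) = (LEAST d. R k (least_path R c k) d)"

text \<open>
  Unbounded search is not primitive recursive in \<open>exists2\<close>. Searching below a bound \<open>N\<close> is, and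
  the value \<open>0\<close> signals failure; a value \<open>Suc c\<close> does not depend on \<open>N\<close>, so that \<open>c\<close> can be
  spoken about by quantifying over \<open>N\<close>.
\<close>

definition bounded_path :: "(nat \<Rightarrow> nat \<Rightarrow> nat \<Rightarrow> bool) \<Rightarrow> nat \<Rightarrow> nat \<Rightarrow> nat \<Rightarrow> nat" where
  "bounded_path R c N k =
     rec_nat (Suc c) (\<lambda>k u. if u = 0 then 0 else bounded_search (R k (u - 1)) N) k"

text \<open>A nonzero value at one stage forces nonzero values at all earlier stages, and each
  successful search returns the true least successor.\<close>

lemma bounded_path_sound: "bounded_path R c N k = Suc d \<Longrightarrow> d = least_path R c k"
proof (induction k arbitrary: d)
  case 0
  then show ?case by (simp add: bounded_path_def)
next
  case (Suc k)
  have eq: "bounded_path R c N (Suc k) = (if bounded_path R c N k = 0 then 0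
      else bounded_search (R k (bounded_path R c N k - 1)) N)"
    by (simp add: bounded_path_def)
  then obtain d' where "bounded_path R c N k = Suc d'"
    using Suc.prems by (cases "bounded_path R c N k") auto
  with Suc eq show ?case by (auto simp: bounded_search_eq split: if_splits)
qed

lemma bounded_path_complete:
  assumes "\<And>j. R j (least_path R c j) (least_path R c (Suc j))" "\<And>j. j \<le> k \<Longrightarrow> least_path R c j < N"
  shows "bounded_path R c N k = Suc (least_path R c k)"
  using assms(2)
proof (induction k)
  case 0
  then show ?case by (simp add: bounded_path_def)
next
  case (Suc k)
  have "bounded_path R c N (Suc k) = bounded_search (R k (least_path R c k)) N"
    using Suc by (simp add: bounded_path_def)
  moreover have "\<exists>n<N. R k (least_path R c k) n"
    using assms(1)[of k] Suc.prems[of "Suc k"] by blast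
  ultimately show ?case by (simp add: bounded_search_eq)
qed

lemma ex_bounded_path_iff:
  assumes "\<And>j. R j (least_path R c j) (least_path R c (Suc j))"
  shows "(\<exists>N. bounded_path R c N k = Suc d) \<longleftrightarrow> d = least_path R c k"
proof -
  \<comment> \<open>A bound above the finitely many path values up to \<open>k\<close> lets every
    search succeed.\<close>
  have "least_path R c j < Suc (Max (least_path R c ` {..k}))" if "j \<le> k" for j
    using that by (intro le_imp_less_Suc Max_ge) auto
  from bounded_path_complete[OF assms this] show ?thesis
    using bounded_path_sound[of R c _ k d] by blast
qed

text \<open>The recursion and the search put further variables in front of the arguments of
  \<open>R\<close>; hence decidability of \<open>R\<close> is assumed for arbitrary computable
  arguments.\<close>

lemma computable_bounded_path:
  assumes "\<And>k a b d. computable k a \<Longrightarrow> computable k b \<Longrightarrow> computable k d \<Longrightarrow>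
      decidable k (\<lambda>F G xs. R F G (a F G xs) (b F G xs) (d F G xs))"
    and "computable k a" "computable k b"
  shows "computable k (\<lambda>F G xs. bounded_path (R F G) c (a F G xs) (b F G xs))"
  unfolding bounded_path_def
  by (intro computable_intros computable_bounded_search assms)

text \<open>\<open>2 * j\<close> is the code of the integer \<open>j\<close>, and
  \<open>2 ^ p - 1\<close> compensates for the successor taken in the denominator by
  \<open>rat_code\<close>.\<close>

definition dyadic_code :: "nat \<Rightarrow> nat \<Rightarrow> nat" where
  "dyadic_code j p = prod_encode (2 * j, 2 ^ p - 1)"

lemma rat_code_dyadic_code: "rat_code (dyadic_code j p) = real j / 2 ^ p"
  by (simp add: dyadic_code_def rat_code_def int_decode_def sum_decode_def of_nat_diff)

lemma computable_dyadic_code: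
  assumes "computable k a" "computable k b"
  shows "computable k (\<lambda>F G xs. dyadic_code (a F G xs) (b F G xs))"
  unfolding dyadic_code_def by (intro computable_intros assms)

section \<open>The search for nested dyadic intervals\<close>

text \<open>
  The pair \<open>j\<close>, \<open>p\<close> stands for the open interval of radius \<open>1 / 2 ^ p\<close> about \<open>j / 2 ^ p\<close>;
  inequalities are cleared of denominators and subtraction.
\<close>

definition dyadic_near :: "nat \<Rightarrow> nat \<Rightarrow> nat \<Rightarrow> nat \<Rightarrow> bool" where
  "dyadic_near j p i m \<longleftrightarrow> i * 2 ^ p < Suc j * 2 ^ m \<and> j * 2 ^ m < i * 2 ^ p + 2 ^ m"

definition dyadic_nested :: "nat \<Rightarrow> nat \<Rightarrow> nat \<Rightarrow> nat \<Rightarrow> bool" where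
  "dyadic_nested i m j p \<longleftrightarrow> 0 < j \<and> j < 2 ^ p \<and>
     Suc j * 2 ^ m < Suc i * 2 ^ p \<and> i * 2 ^ p + 2 ^ m < j * 2 ^ m + 2 ^ p"

text \<open>
  The summands \<open>2 ^ p\<close> and \<open>2 * 2 ^ k\<close> over the common denominators allow for the error \<open>1 / 2 ^ n\<close>
  of the \<open>n\<close>th approximation of each real.
\<close>

definition step_formula ::
  "((nat \<Rightarrow> nat) \<Rightarrow> nat) \<Rightarrow> ((nat \<Rightarrow> nat) \<Rightarrow> nat) \<Rightarrow> nat \<Rightarrow> nat \<Rightarrow> nat \<Rightarrow> bool" where
  "step_formula F G k c d \<longleftrightarrow> (\<exists>i m j p. c = prod_encode (i, m) \<and> d = prod_encode (j, p) \<and>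
     dyadic_nested i m j p \<and>
     (\<exists>n. \<not> rat_code (G (case_nat k (case_nat n (\<lambda>_. dyadic_code j p)))) \<le>
             rat_code 0 + real (2 ^ n + 2 ^ p) / real (2 ^ (n + p))) \<and>
     (\<forall>i' m'. dyadic_near j p i' m' \<longrightarrow>
        (\<forall>n. rat_code (F (case_nat n (\<lambda>_. dyadic_code j p))) \<le>
             rat_code (F (case_nat n (\<lambda>_. dyadic_code i' m'))) +
               real (2 ^ n + 2 * 2 ^ k) / real (2 ^ (n + k)))))"

lemma decidable_step_formula:
  assumes "computable k a" "computable k b" "computable k d"
  shows "decidable k (\<lambda>F G xs. step_formula F G (a F G xs) (b F G xs) (d F G xs))"
  unfolding step_formula_def dyadic_nested_def dyadic_near_def
  by (intro computable_intros decidable_rat_code_le computable_dyadic_code assms)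

text \<open>The centre reached at stage \<open>n + 2\<close> is rounded down to a multiple of
  \<open>1 / 2 ^ (n + 2)\<close>. Along good steps centres lie below 1, which justifies the search
  bound; the final subtraction undoes the shift of the search. The start
  \<open>prod_encode (1, 1)\<close> is the whole interval (0, 1).\<close>

definition path_approximation :: "(nat \<Rightarrow> nat \<Rightarrow> nat \<Rightarrow> bool) \<Rightarrow> nat \<Rightarrow> nat" where
  "path_approximation R n = dyadic_code (bounded_search (\<lambda>j. \<exists>N i m.
      bounded_path R (prod_encode (1, 1)) N (n + 2) = Suc (prod_encode (i, m)) \<and>
      j * 2 ^ m \<le> i * 2 ^ (n + 2) \<and> i * 2 ^ (n + 2) < Suc j * 2 ^ m) (2 ^ (n + 2)) - 1) (n + 2)"

lemma computable_path_approximation: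
  "computable (Suc 0) (\<lambda>F G xs. path_approximation (step_formula F G) (hd xs))"
  unfolding path_approximation_def
  by (intro computable_intros computable_dyadic_code computable_bounded_search
      computable_bounded_path decidable_step_formula)

section \<open>Continuity points of upper semi-continuous functions\<close>

lemma represents_real_bound:
  assumes "represents_real \<alpha> x"
  shows "\<bar>rat_code (\<alpha> n) - x\<bar> \<le> (1/2) ^ n"
proof -
  have "(\<lambda>i. rat_code (\<alpha> (n + i))) \<longlonglongrightarrow> x"
    using assms LIMSEQ_ignore_initial_segment[of "\<lambda>n. rat_code (\<alpha> n)" x n]
    by (simp add: represents_real_def add.commute)
  then have "(\<lambda>i. \<bar>rat_code (\<alpha> n) - rat_code (\<alpha> (n + i))\<bar>) \<longlonglongrightarrow> \<bar>rat_code (\<alpha> n) - x\<bar>"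
    by (intro tendsto_intros)
  then show ?thesis
    by (rule LIMSEQ_le_const2) (use assms in \<open>auto simp: represents_real_def less_imp_le\<close>)
qed

lemma represents_real_const: "represents_real (\<lambda>_. c) (rat_code c)"
  by (simp add: represents_real_def)

text \<open>The slack \<open>2 * (1/2) ^ n\<close> covers one approximation error on each side and
  vanishes in the limit, so a non-strict comparison is a universal arithmetical statement.\<close>

lemma represents_real_le_iff:
  assumes "represents_real \<alpha> x" "represents_real \<beta> y"
  shows "x \<le> y + d \<longleftrightarrow> (\<forall>n. rat_code (\<alpha> n) \<le> rat_code (\<beta> n) + (d + 2 * (1/2) ^ n))"
proof
  assume "x \<le> y + d"
  then show "\<forall>n. rat_code (\<alpha> n) \<le> rat_code (\<beta> n) + (d + 2 * (1/2) ^ n)"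
    using represents_real_bound[OF assms(1)] represents_real_bound[OF assms(2)]
    by (smt (verit))
next
  assume *: "\<forall>n. rat_code (\<alpha> n) \<le> rat_code (\<beta> n) + (d + 2 * (1/2) ^ n)"
  have "(\<lambda>n. rat_code (\<beta> n) + (d + 2 * (1/2) ^ n)) \<longlonglongrightarrow> y + (d + 2 * 0)"
    using assms by (intro tendsto_intros LIMSEQ_power_zero) (auto simp: represents_real_def)
  then have "x \<le> y + (d + 2 * 0)"
    using assms * by (intro LIMSEQ_le[of "\<lambda>n. rat_code (\<alpha> n)" x]) (auto simp: represents_real_def)
  then show "x \<le> y + d" by simp
qed

lemma represents_real_gt_iff:
  assumes "represents_real \<alpha> x"
  shows "d < x \<longleftrightarrow> (\<exists>n. d + (1/2) ^ n < rat_code (\<alpha> n))"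
proof
  assume "d < x"
  \<comment> \<open>One half of the gap pays for the approximation error, the other for the slack
    \<open>(1/2) ^ n\<close>.\<close>
  then obtain n where n: "(1/2) ^ n < (x - d) / 2"
    using real_arch_pow_inv[of "(x - d) / 2" "1/2"] by auto
  then show "\<exists>n. d + (1/2) ^ n < rat_code (\<alpha> n)"
    using represents_real_bound[OF assms, of n] by (intro exI[of _ n]) (simp add: abs_if split: if_splits)
next
  assume "\<exists>n. d + (1/2) ^ n < rat_code (\<alpha> n)"
  then obtain n where "d + (1/2) ^ n < rat_code (\<alpha> n)" ..
  then show "d < x"
    using represents_real_bound[OF assms, of n] by (simp add: abs_if split: if_splits)
qed

section \<open>Dyadic intervals and good steps\<close>

lemma dyadic_near_iff:
  "dyadic_near j p i m \<longleftrightarrow> \<bar>real i / 2 ^ m - real j / 2 ^ p\<bar> < 1 / 2 ^ p"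
proof -
  have "i * 2 ^ p < Suc j * 2 ^ m \<longleftrightarrow> real (i * 2 ^ p) < real (Suc j * 2 ^ m)"
    by (simp only: of_nat_less_iff)
  also have "\<dots> \<longleftrightarrow> real i / 2 ^ m < real j / 2 ^ p + 1 / 2 ^ p"
    by (simp add: field_simps)
  finally have 1: "i * 2 ^ p < Suc j * 2 ^ m \<longleftrightarrow> real i / 2 ^ m < real j / 2 ^ p + 1 / 2 ^ p" .
  have "j * 2 ^ m < i * 2 ^ p + 2 ^ m \<longleftrightarrow> real (j * 2 ^ m) < real (i * 2 ^ p + 2 ^ m)"
    by (simp only: of_nat_less_iff)
  also have "\<dots> \<longleftrightarrow> real j / 2 ^ p < real i / 2 ^ m + 1 / 2 ^ p"
    by (simp add: field_simps)
  finally show ?thesis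
    unfolding dyadic_near_def 1 by (auto simp: abs_less_iff)
qed

lemma dyadic_nested_iff:
  "dyadic_nested i m j p \<longleftrightarrow> 0 < j \<and> j < 2 ^ p \<and>
     real j / 2 ^ p + 1 / 2 ^ p < real i / 2 ^ m + 1 / 2 ^ m \<and>
     real i / 2 ^ m - 1 / 2 ^ m < real j / 2 ^ p - 1 / 2 ^ p"
proof -
  have "Suc j * 2 ^ m < Suc i * 2 ^ p \<longleftrightarrow> real (Suc j * 2 ^ m) < real (Suc i * 2 ^ p)"
    by (simp only: of_nat_less_iff)
  also have "\<dots> \<longleftrightarrow> real j / 2 ^ p + 1 / 2 ^ p < real i / 2 ^ m + 1 / 2 ^ m"
    by (simp add: field_simps)
  finally have 1: "Suc j * 2 ^ m < Suc i * 2 ^ p \<longleftrightarrow>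
    real j / 2 ^ p + 1 / 2 ^ p < real i / 2 ^ m + 1 / 2 ^ m" .
  have "i * 2 ^ p + 2 ^ m < j * 2 ^ m + 2 ^ p \<longleftrightarrow>
      real (i * 2 ^ p + 2 ^ m) < real (j * 2 ^ m + 2 ^ p)"
    by (simp only: of_nat_less_iff)
  also have "\<dots> \<longleftrightarrow> real i / 2 ^ m - 1 / 2 ^ m < real j / 2 ^ p - 1 / 2 ^ p"
    by (simp add: field_simps)
  finally show ?thesis
    unfolding dyadic_nested_def 1 by auto
qed

text \<open>The exact real counterpart of \<open>step_formula\<close>. Letting the last clause range
  over dyadic points only keeps the condition arithmetical.\<close>

definition good_step :: "(real \<Rightarrow> real) \<Rightarrow> (real \<Rightarrow> nat \<Rightarrow> real) \<Rightarrow> nat \<Rightarrow> nat \<Rightarrow> nat \<Rightarrow> bool" where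
  "good_step f \<Psi> k c d \<longleftrightarrow> (\<exists>i m j p. c = prod_encode (i, m) \<and> d = prod_encode (j, p) \<and>
     dyadic_nested i m j p \<and> 1 / 2 ^ p < \<Psi> (real j / 2 ^ p) k \<and>
     (\<forall>i' m'. dyadic_near j p i' m' \<longrightarrow>
        f (real j / 2 ^ p) \<le> f (real i' / 2 ^ m') + (1/2) ^ k))"

lemma dyadic_interval_unit:
  assumes "0 < j" "j < (2::nat) ^ p" "\<bar>y - real j / 2 ^ p\<bar> < 1 / 2 ^ p"
  shows "y \<in> {0..1}"
proof -
  have "real j + 1 \<le> 2 ^ p"
    using assms(2) by (metis Suc_leI of_nat_Suc of_nat_le_iff of_nat_numeral of_nat_power add.commute)
  then have "real j / 2 ^ p + 1 / 2 ^ p \<le> 1" by (simp add: field_simps)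
  moreover have "1 / 2 ^ p \<le> real j / 2 ^ p"
    using assms(1) by (simp add: divide_right_mono)
  ultimately show ?thesis using assms(3) by (auto simp: abs_less_iff)
qed

text \<open>The right-hand side is free of \<open>F\<close> and \<open>G\<close>, whence the search
  depends on \<open>f\<close> and \<open>\<Psi>\<close> alone. The representations are guaranteed
  only on the unit interval, so nestedness must be known before the values of \<open>F\<close> and
  \<open>G\<close> can be interpreted.\<close>

lemma step_formula_eq_good_step:
  assumes F: "represents_fun F f" and G: "represents_fun_nat G \<Psi>"
  shows "step_formula F G = good_step f \<Psi>"
proof (intro ext)
  fix k c d
  \<comment> \<open>The case \<open>a = 1\<close>, with \<open>p\<close> for \<open>k\<close>,
    serves the strict comparison with the modulus; the case \<open>a = 2\<close> serves the
    comparison of two values of \<open>f\<close>.\<close>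
  have sum2: "real (2 ^ n + a * 2 ^ k) / real (2 ^ (n + k)) = (1/2) ^ k + a * (1/2) ^ n" for n k a :: nat
    by (simp add: field_simps power_add power_divide)
  have F': "represents_real (\<lambda>n. F (case_nat n (\<lambda>_. dyadic_code j p))) (f (real j / 2 ^ p))"
    if "real j / 2 ^ p \<in> {0..1}" for j p
    using F represents_real_const[of "dyadic_code j p"] that
    unfolding represents_fun_def rat_code_dyadic_code by blast
  have G': "represents_real (\<lambda>n. G (case_nat k (case_nat n (\<lambda>_. dyadic_code j p)))) (\<Psi> (real j / 2 ^ p) k)"
    if "real j / 2 ^ p \<in> {0..1}" for j p
    using G represents_real_const[of "dyadic_code j p"] that
    unfolding represents_fun_nat_def rat_code_dyadic_code by blast
  have 1: "(\<exists>n. \<not> rat_code (G (case_nat k (case_nat n (\<lambda>_. dyadic_code j p)))) \<le>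
             rat_code 0 + real (2 ^ n + 2 ^ p) / real (2 ^ (n + p))) \<longleftrightarrow>
          1 / 2 ^ p < \<Psi> (real j / 2 ^ p) k"
    if "dyadic_nested i m j p" for i m j p
  proof -
    have "real j / 2 ^ p \<in> {0..1}"
      using that dyadic_interval_unit[of j p "real j / 2 ^ p"] by (simp add: dyadic_nested_def)
    moreover have "rat_code 0 = 0"
      using rat_code_dyadic_code[of 0 0] by (simp add: dyadic_code_def prod_encode_def)
    ultimately show ?thesis
      using represents_real_gt_iff[OF G', of j p "1 / 2 ^ p"] sum2[of _ 1 p]
      by (simp add: not_le power_divide add.commute)
  qed
  have 2: "(\<forall>n. rat_code (F (case_nat n (\<lambda>_. dyadic_code j p))) \<le>
             rat_code (F (case_nat n (\<lambda>_. dyadic_code i' m'))) +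
               real (2 ^ n + 2 * 2 ^ k) / real (2 ^ (n + k))) \<longleftrightarrow>
        f (real j / 2 ^ p) \<le> f (real i' / 2 ^ m') + (1/2) ^ k"
    if "dyadic_nested i m j p" "dyadic_near j p i' m'" for i m j p i' m'
  proof -
    have "real j / 2 ^ p \<in> {0..1}" "real i' / 2 ^ m' \<in> {0..1}"
      using that dyadic_interval_unit[of j p "real j / 2 ^ p"]
        dyadic_interval_unit[of j p "real i' / 2 ^ m'"]
      by (simp_all add: dyadic_nested_def dyadic_near_iff)
    from represents_real_le_iff[OF F'[OF this(1)] F'[OF this(2)], of "(1/2) ^ k"] sum2[of _ 2 k]
    show ?thesis by simp
  qed
  show "step_formula F G k c d = good_step f \<Psi> k c d"
    unfolding step_formula_def good_step_def
    \<comment> \<open>The congruence rules supply nestedness and nearness as the hypotheses of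
      \<open>1\<close> and \<open>2\<close>.\<close>
    by (intro ex_cong1 conj_cong refl 1 all_cong1 imp_cong 2)
qed

section \<open>Existence of good steps\<close>

lemma dyadic_between:
  fixes a b :: real
  assumes "0 \<le> a" "a < b"
  shows "\<exists>j p. a < real j / 2 ^ p \<and> real j / 2 ^ p < b"
proof -
  obtain p where p: "(1/2) ^ p < b - a"
    using real_arch_pow_inv[of "b - a" "1/2"] assms by auto
  \<comment> \<open>The numerator of the first multiple of \<open>1 / 2 ^ p\<close> above
    \<open>a\<close>; the mesh is finer than \<open>b - a\<close>, so this multiple lies below
    \<open>b\<close>.\<close>
  let ?j = "nat (\<lfloor>a * 2 ^ p\<rfloor> + 1)"
  have j: "real ?j = of_int \<lfloor>a * 2 ^ p\<rfloor> + 1" using assms by simp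
  have "a * 2 ^ p < real ?j" unfolding j by linarith
  then have "a < real ?j / 2 ^ p" by (simp add: field_simps)
  have "real ?j \<le> a * 2 ^ p + 1" unfolding j by linarith
  also have "\<dots> < b * 2 ^ p" using p by (simp add: field_simps power_divide)
  finally have "real ?j / 2 ^ p < b" by (simp add: field_simps)
  with \<open>a < real ?j / 2 ^ p\<close> show ?thesis by blast
qed

lemma usco_openin_less:
  assumes "usco f" "S \<subseteq> {0..1}"
  shows "openin (top_of_set S) {y \<in> S. f y < c}"
  unfolding openin_contains_ball
proof (intro conjI ballI)
  fix x assume x: "x \<in> {y \<in> S. f y < c}"
  then obtain N where N: "\<forall>z \<in> ball x ((1/2) ^ N) \<inter> {0..1}. f z < c"
    using assms unfolding usco_def usco_at_def by blast
  then show "\<exists>e>0. ball x e \<inter> S \<subseteq> {y \<in> S. f y < c}"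
    using assms(2) by (intro exI[of _ "(1/2) ^ N"]) auto
qed auto

text \<open>The sets where \<open>f\<close> is below \<open>- n\<close> are relatively open and have
  empty intersection, as \<open>f\<close> is real-valued. By Baire one of them is not dense, and
  around a point off its closure \<open>f\<close> is at least \<open>- n\<close>.\<close>

lemma usco_bounded_below_subinterval:
  fixes a b :: real
  assumes "usco f" "0 \<le> a" "a < b" "b \<le> 1"
  shows "\<exists>u v c. a \<le> u \<and> u < v \<and> v \<le> b \<and> (\<forall>y\<in>{u<..<v}. c \<le> f y)"
proof -
  define T where "T n = {y \<in> {a..b}. f y < - real n}" for n :: nat
  have "\<exists>n. \<not> {a..b} \<subseteq> closure (T n)"
  proof (rule ccontr)
    assume "\<nexists>n. \<not> {a..b} \<subseteq> closure (T n)"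
    moreover have "openin (top_of_set {a..b}) (T n)" for n
      unfolding T_def using assms by (intro usco_openin_less) auto
    ultimately have "{a..b} \<subseteq> closure (\<Inter> (range T))"
      by (intro Baire) auto
    moreover have "\<Inter> (range T) = {}"
    proof (rule ccontr)
      assume "\<Inter> (range T) \<noteq> {}"
      then obtain y where "\<And>n. f y < - real n" by (auto simp: T_def)
      then show False using reals_Archimedean2[of "- f y"] by (smt (verit))
    qed
    ultimately show False using assms by simp
  qed
  then obtain n y where y: "y \<in> {a..b}" "y \<notin> closure (T n)" by blast
  then obtain e where e: "0 < e" "\<And>z. z \<in> T n \<Longrightarrow> e \<le> dist z y"
    unfolding closure_approachable by (auto simp: not_less)
  show ?thesis
  proof (intro exI conjI ballI)
    show "a \<le> max a (y - e)" "max a (y - e) < min b (y + e)" "min b (y + e) \<le> b"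
      using y e assms by auto
    fix z assume "z \<in> {max a (y - e)<..<min b (y + e)}"
    then have "z \<in> {a..b}" "dist z y < e" by (auto simp: dist_real_def abs_less_iff)
    then show "- real n \<le> f z" using e(2)[of z] by (force simp: T_def)
  qed
qed

lemma good_step_exists:
  assumes f: "usco f" and \<Psi>: "usco_modulus f \<Psi>" and i: "0 < i" "i < 2 ^ m"
  shows "\<exists>d. good_step f \<Psi> k (prod_encode (i, m)) d"
proof -
  let ?a = "real i / 2 ^ m - 1 / 2 ^ m" and ?b = "real i / 2 ^ m + 1 / 2 ^ m"
  have ab: "0 \<le> ?a" "?b \<le> 1"
  proof -
    have "real i + 1 \<le> 2 ^ m"
      using i(2) by (metis Suc_leI of_nat_Suc of_nat_le_iff of_nat_numeral of_nat_power add.commute)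
    then show "?b \<le> 1" by (simp add: field_simps)
    show "0 \<le> ?a" using i(1) by (simp add: divide_right_mono)
  qed
  obtain u v c where uv: "?a \<le> u" "u < v" "v \<le> ?b" and c: "\<And>y. y \<in> {u<..<v} \<Longrightarrow> c \<le> f y"
    using usco_bounded_below_subinterval[OF f ab(1) _ ab(2)] by (auto simp del: greaterThanLessThan_iff)
  \<comment> \<open>The bound \<open>c\<close> gives the values at these points a finite infimum, so
    a nearly minimal value exists.\<close>
  define D where "D = {real j / 2 ^ p |j p. real j / 2 ^ p \<in> {u<..<v}}"
  have "D \<noteq> {}" using dyadic_between[of u v] uv ab unfolding D_def by fastforce
  have D: "D \<subseteq> {u<..<v}" by (auto simp: D_def)
  have bdd: "bdd_below (f ` D)" using c D by (intro bdd_belowI[of _ c]) auto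
  have "Inf (f ` D) < Inf (f ` D) + (1/2) ^ k" by simp
  then obtain q where q: "q \<in> D" "f q < Inf (f ` D) + (1/2) ^ k"
    using \<open>D \<noteq> {}\<close> bdd by (subst (asm) cInf_less_iff) auto
  then obtain j0 p0 where q0: "q = real j0 / 2 ^ p0" by (auto simp: D_def)
  have quv: "u < q" "q < v" using q D by auto
  then have "q \<in> {0..1}" using uv ab by auto
  then have "0 < \<Psi> q k" using \<Psi> by (auto simp: usco_modulus_def)
  \<comment> \<open>A radius below \<open>e\<close> is below the modulus and keeps the interval
    about \<open>q\<close> strictly inside (u, v).\<close>
  define e where "e = min (\<Psi> q k) (min (q - u) (v - q))"
  have "0 < e" using \<open>0 < \<Psi> q k\<close> quv by (simp add: e_def)
  then obtain r where r: "(1/2) ^ r < e"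
    using real_arch_pow_inv[of e "1/2"] by auto
  \<comment> \<open>Centre and radius share the exponent \<open>p\<close>; expanding the fraction by
    \<open>2 ^ r\<close> shrinks the radius without moving \<open>q\<close>.\<close>
  define p where "p = p0 + r"
  define j where "j = j0 * 2 ^ r"
  have qj: "real j / 2 ^ p = q" by (simp add: q0 p_def j_def power_add)
  have "(1/2 :: real) ^ p \<le> (1/2) ^ r" by (simp add: p_def power_decreasing)
  then have small: "1 / 2 ^ p < \<Psi> q k" "1 / 2 ^ p < q - u" "1 / 2 ^ p < v - q"
    using r by (auto simp: e_def power_divide)
  have nested: "dyadic_nested i m j p"
    unfolding dyadic_nested_iff qj
  proof (intro conjI)
    have "0 < q" "q < 1" using quv uv ab by auto
    then have "0 < real j" "real j < real (2 ^ p)"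
      unfolding qj[symmetric] by (simp_all add: zero_less_divide_iff divide_less_eq)
    then show "0 < j" "j < 2 ^ p" by (simp_all only: of_nat_less_iff of_nat_0_less_iff)
    show "q + 1 / 2 ^ p < ?b" "?a < q - 1 / 2 ^ p" using small uv by auto
  qed
  have "f q \<le> f (real i' / 2 ^ m') + (1/2) ^ k" if "dyadic_near j p i' m'" for i' m'
  proof -
    have "real i' / 2 ^ m' \<in> {u<..<v}"
      using that small unfolding dyadic_near_iff qj by (auto simp: abs_less_iff)
    then have "real i' / 2 ^ m' \<in> D" unfolding D_def by blast
    then have "Inf (f ` D) \<le> f (real i' / 2 ^ m')" using bdd by (intro cInf_lower) auto
    then show ?thesis using q by simp
  qed
  then have "good_step f \<Psi> k (prod_encode (i, m)) (prod_encode (j, p))"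
    unfolding good_step_def using nested small qj by blast
  then show ?thesis ..
qed

section \<open>Small oscillation and the limit point\<close>

lemma good_step_oscillation:
  assumes f: "usco f" and \<Psi>: "usco_modulus f \<Psi>"
    and good: "good_step f \<Psi> k (prod_encode (i, m)) (prod_encode (j, p))"
    and y: "\<bar>y - real j / 2 ^ p\<bar> < 1 / 2 ^ p"
  shows "\<bar>f y - f (real j / 2 ^ p)\<bar> \<le> (1/2) ^ k"
proof -
  let ?q = "real j / 2 ^ p"
  have j: "0 < j" "j < 2 ^ p" and rad: "1 / 2 ^ p < \<Psi> ?q k"
    and low: "\<And>i' m'. dyadic_near j p i' m' \<Longrightarrow> f ?q \<le> f (real i' / 2 ^ m') + (1/2) ^ k"
    using good by (auto simp: good_step_def dyadic_nested_def)
  have y01: "y \<in> {0..1}" and q01: "?q \<in> {0..1}"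
    using dyadic_interval_unit[OF j] y by auto
  have "y \<in> ball ?q (\<Psi> ?q k) \<inter> {0..1}"
    using y rad y01 by (auto simp: dist_real_def abs_minus_commute)
  then have up: "f y < f ?q + (1/2) ^ k"
    using \<Psi> q01 unfolding usco_modulus_def by blast
  have "f ?q - (1/2) ^ k \<le> f y"
  proof (rule ccontr)
    assume "\<not> ?thesis"
    then obtain N where N: "\<And>z. z \<in> ball y ((1/2) ^ N) \<inter> {0..1} \<Longrightarrow> f z < f ?q - (1/2) ^ k"
      using f y01 unfolding usco_def usco_at_def by (metis not_le)
    \<comment> \<open>A dyadic point between \<open>a\<close> and \<open>b\<close> lies both in the
      neighbourhood of \<open>y\<close> where \<open>f\<close> is too small and in the interval
      about \<open>?q\<close> where the dyadic lower bound holds.\<close>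
    define a where "a = max (y - (1/2) ^ N) (?q - 1 / 2 ^ p)"
    define b where "b = min (y + (1/2) ^ N) (?q + 1 / 2 ^ p)"
    have "1 / 2 ^ p \<le> ?q" using j by (simp add: divide_right_mono)
    then have "0 \<le> a" by (simp add: a_def)
    moreover have "a < b"
      using y by (auto simp: a_def b_def abs_less_iff max_def min_def add_pos_pos less_diff_eq)
    ultimately obtain i' m' where z: "a < real i' / 2 ^ m'" "real i' / 2 ^ m' < b"
      using dyadic_between by blast
    let ?z = "real i' / 2 ^ m'"
    have near: "dyadic_near j p i' m'"
      using z by (auto simp: dyadic_near_iff a_def b_def abs_less_iff)
    then have "?z \<in> {0..1}" using dyadic_interval_unit[OF j] by (simp add: dyadic_near_iff)
    moreover have "?z \<in> ball y ((1/2) ^ N)"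
      using z by (auto simp: a_def b_def dist_real_def abs_less_iff)
    ultimately have "f ?z < f ?q - (1/2) ^ k" using N by blast
    with low[OF near] show False by simp
  qed
  with up show ?thesis by (simp add: abs_le_iff)
qed

lemma represents_realI:
  assumes "\<And>n. \<bar>rat_code (\<alpha> n) - x\<bar> < (1/2) ^ n / 2"
  shows "represents_real \<alpha> x"
  unfolding represents_real_def
proof (intro conjI allI)
  fix n i
  have "(1/2 :: real) ^ (n + i) \<le> (1/2) ^ n" by (simp add: power_decreasing)
  then show "\<bar>rat_code (\<alpha> n) - rat_code (\<alpha> (n + i))\<bar> < (1/2) ^ n"
    using assms[of n] assms[of "n + i"] by linarith
next
  have "(\<lambda>n. rat_code (\<alpha> n) - x) \<longlonglongrightarrow> 0"
  proof (rule Lim_null_comparison)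
    show "\<forall>\<^sub>F n in sequentially. norm (rat_code (\<alpha> n) - x) \<le> (1/2) ^ n"
      using assms by (intro always_eventually allI)
        (smt (verit) real_norm_def zero_less_power half_gt_zero field_sum_of_halves)
  qed (simp add: LIMSEQ_power_zero)
  then show "(\<lambda>n. rat_code (\<alpha> n)) \<longlonglongrightarrow> x" by (simp add: LIM_zero_iff)
qed

lemma path_approximation_bound:
  assumes R: "\<And>j. R j (least_path R (prod_encode (1, 1)) j) (least_path R (prod_encode (1, 1)) (Suc j))"
    and path: "least_path R (prod_encode (1, 1)) (n + 2) = prod_encode (i, m)" and i: "i < 2 ^ m"
  shows "\<bar>rat_code (path_approximation R n) - real i / 2 ^ m\<bar> < 1 / 2 ^ (n + 2)"
proof -
  \<comment> \<open>Every successful bounded path yields the same code, so the quantifiers over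
    \<open>N\<close>, \<open>i\<close> and \<open>m\<close> collapse to this condition, which makes
    \<open>j\<close> the integer part of the scaled centre.\<close>
  define P where "P j \<longleftrightarrow> j * 2 ^ m \<le> i * 2 ^ (n + 2) \<and> i * 2 ^ (n + 2) < Suc j * 2 ^ m" for j
  have "(\<exists>N i m. bounded_path R (prod_encode (1, 1)) N (n + 2) = Suc (prod_encode (i, m)) \<and>
      j * 2 ^ m \<le> i * 2 ^ (n + 2) \<and> i * 2 ^ (n + 2) < Suc j * 2 ^ m) \<longleftrightarrow> P j" for j
    using ex_bounded_path_iff[of R "prod_encode (1, 1)", OF R, of "n + 2"] path unfolding P_def
    by (metis prod.inject prod_encode_eq)
  then have eq: "path_approximation R n = dyadic_code (bounded_search P (2 ^ (n + 2)) - 1) (n + 2)"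
    by (simp only: path_approximation_def)
  let ?j = "i * 2 ^ (n + 2) div 2 ^ m"
  have "P ?j"
    unfolding P_def by (simp add: div_times_less_eq_dividend dividend_less_div_times)
  moreover have "?j < 2 ^ (n + 2)"
    using i by (simp add: div_less_iff_less_mult)
  ultimately have "bounded_search P (2 ^ (n + 2)) - 1 = (LEAST j. P j)"
    by (auto simp: bounded_search_eq)
  moreover have "P (LEAST j. P j)" using \<open>P ?j\<close> by (rule LeastI)
  ultimately obtain j where j: "P j" "path_approximation R n = dyadic_code j (n + 2)"
    using eq by simp
  have "real (j * 2 ^ m) \<le> real (i * 2 ^ (n + 2))" "real (i * 2 ^ (n + 2)) < real (Suc j * 2 ^ m)"
    using j(1) unfolding P_def by (simp_all only: of_nat_le_iff of_nat_less_iff)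
  then have "real j / 2 ^ (n + 2) \<le> real i / 2 ^ m"
    "real i / 2 ^ m < real j / 2 ^ (n + 2) + 1 / 2 ^ (n + 2)"
    by (simp_all add: field_simps)
  then show ?thesis
    unfolding j(2) rat_code_dyadic_code by (simp add: abs_less_iff)
qed

lemma usco_continuity_point:
  assumes f: "usco f" and \<Psi>: "usco_modulus f \<Psi>"
  shows "\<exists>x \<in> continuity_points f. represents_real (path_approximation (good_step f \<Psi>)) x"
proof -
  define c where "c = least_path (good_step f \<Psi>) (prod_encode (1, 1))"
  define i where "i k = fst (prod_decode (c k))" for k
  define m where "m k = snd (prod_decode (c k))" for k
  have c: "c k = prod_encode (i k, m k)" for k by (simp add: i_def m_def)
  have step: "good_step f \<Psi> k (c k) (c (Suc k))" if "0 < i k" "i k < 2 ^ m k" for k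
    using good_step_exists[OF f \<Psi> that, of k] unfolding c[symmetric]
    by (simp add: c_def LeastI_ex)
  \<comment> \<open>The invariant guarantees a successor, so the least one is admissible, and
    nestedness of that one restores the invariant.\<close>
  have im: "0 < i k \<and> i k < 2 ^ m k" for k
  proof (induction k)
    case 0
    show ?case by (simp add: i_def m_def c_def)
  next
    case (Suc k)
    then show ?case
      using step[of k] unfolding good_step_def c by (auto simp: dyadic_nested_def)
  qed
  have good: "good_step f \<Psi> k (prod_encode (i k, m k)) (prod_encode (i (Suc k), m (Suc k)))" for k
    using step[of k] im[of k] unfolding c by simp
  define l where "l k = real (i k) / 2 ^ m k - 1 / 2 ^ m k" for k
  define h where "h k = real (i k) / 2 ^ m k + 1 / 2 ^ m k" for k
  have "dyadic_nested (i k) (m k) (i (Suc k)) (m (Suc k))" for k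
    using good[of k] by (auto simp: good_step_def)
  then have l_less: "l k < l (Suc k)" and h_less: "h (Suc k) < h k" for k
    by (auto simp: dyadic_nested_iff l_def h_def)
  \<comment> \<open>Strict nesting shrinks the radius, hence raises the exponent, at every
    stage.\<close>
  have m: "k \<le> m k" for k
  proof (induction k)
    case (Suc k)
    have "1 / 2 ^ m (Suc k) < (1 / 2 ^ m k :: real)"
      using l_less[of k] h_less[of k] by (simp add: l_def h_def)
    then have "m k < m (Suc k)" by (simp add: field_simps)
    with Suc show ?case by simp
  qed simp
  have "incseq l" using l_less by (intro incseq_SucI less_imp_le)
  have "decseq h" using h_less by (intro decseq_SucI less_imp_le)
  have lh: "l j < h k" for j k
  proof -
    have "l j \<le> l (max j k)" using \<open>incseq l\<close> by (rule incseqD) simp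
    also have "\<dots> < h (max j k)" by (simp add: l_def h_def)
    also have "\<dots> \<le> h k" using \<open>decseq h\<close> by (rule decseqD) simp
    finally show ?thesis .
  qed
  define x where "x = (SUP k. l k)"
  have bdd: "bdd_above (range l)"
    using lh[THEN less_imp_le, of _ 0] by (intro bdd_aboveI[of _ "h 0"]) blast
  \<comment> \<open>Strict nesting puts the limit inside every open interval, so each interval is a
    neighbourhood of \<open>x\<close>.\<close>
  have lx: "l k < x" for k
    using l_less[of k] cSUP_upper[OF _ bdd, of "Suc k"] by (simp add: x_def)
  have xh: "x < h k" for k
  proof -
    have "x \<le> h (Suc k)"
      unfolding x_def using lh[THEN less_imp_le, of _ "Suc k"] by (intro cSUP_least) simp_all
    with h_less[of k] show ?thesis by simp
  qed
  have near_iff: "\<bar>z - real (i k) / 2 ^ m k\<bar> < 1 / 2 ^ m k \<longleftrightarrow> l k < z \<and> z < h k" for k z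
    by (auto simp: l_def h_def abs_less_iff)
  have near_x: "\<bar>x - real (i k) / 2 ^ m k\<bar> < 1 / 2 ^ m k" for k
    unfolding near_iff using lx xh by simp
  have x01: "x \<in> {0..1}"
    using im[of 0] by (intro dyadic_interval_unit[OF _ _ near_x[of 0]]) simp_all
  have "continuous (at x within {0..1}) f"
    unfolding continuous_within_eps_delta
  proof (intro allI impI)
    fix e :: real assume "0 < e"
    then obtain k where k: "(1/2) ^ k < e / 2"
      using real_arch_pow_inv[of "e / 2" "1/2"] by auto
    \<comment> \<open>The step at stage \<open>k\<close> controls \<open>f\<close> on the interval
      of stage \<open>Suc k\<close>. Both \<open>z\<close> and \<open>x\<close> lie there, and each
      differs in value from the centre by less than \<open>e / 2\<close>.\<close>
    let ?q = "real (i (Suc k)) / 2 ^ m (Suc k)"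
    let ?d = "min (x - l (Suc k)) (h (Suc k) - x)"
    have osc: "\<bar>f z - f ?q\<bar> \<le> (1/2) ^ k" if "l (Suc k) < z" "z < h (Suc k)" for z
      by (rule good_step_oscillation[OF f \<Psi> good]) (unfold near_iff, use that in simp)
    have "dist (f z) (f x) < e" if "dist z x < ?d" for z
    proof -
      have "l (Suc k) < z" "z < h (Suc k)"
        using that by (auto simp: dist_real_def abs_less_iff)
      from osc[OF this] osc[OF lx xh] k show ?thesis by (simp add: dist_real_def)
    qed
    moreover have "0 < ?d" using lx xh by simp
    ultimately show "\<exists>d>0. \<forall>z\<in>{0..1}. dist z x < d \<longrightarrow> dist (f z) (f x) < e" by blast
  qed
  with x01 have "x \<in> continuity_points f" by (simp add: continuity_points_def)
  moreover have "represents_real (path_approximation (good_step f \<Psi>)) x"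
  proof (rule represents_realI)
    fix n
    \<comment> \<open>Rounding and the distance from centre to limit each cost less than
      \<open>1 / 2 ^ (n + 2)\<close>; two such errors give the \<open>(1/2) ^ n / 2\<close> demanded
      by \<open>represents_realI\<close>.\<close>
    let ?q = "real (i (n + 2)) / 2 ^ m (n + 2)"
    have "\<bar>rat_code (path_approximation (good_step f \<Psi>) n) - ?q\<bar> < 1 / 2 ^ (n + 2)"
    proof (rule path_approximation_bound, fold c_def)
      show "good_step f \<Psi> k (c k) (c (Suc k))" for k using step im by simp
      show "c (n + 2) = prod_encode (i (n + 2), m (n + 2))" by (rule c)
      show "i (n + 2) < 2 ^ m (n + 2)" using im by simp
    qed
    moreover have "\<bar>x - ?q\<bar> < 1 / 2 ^ m (n + 2)"
      by (rule near_x)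
    moreover have "1 / 2 ^ m (n + 2) \<le> (1 / 2 ^ (n + 2) :: real)"
      using m[of "n + 2"] by (intro divide_left_mono power_increasing) auto
    ultimately have "\<bar>rat_code (path_approximation (good_step f \<Psi>) n) - x\<bar> < 2 * (1 / 2 ^ (n + 2))"
      by linarith
    also have "\<dots> = (1/2) ^ n / 2" by (simp add: power_divide)
    finally show "\<bar>rat_code (path_approximation (good_step f \<Psi>) n) - x\<bar> < (1/2) ^ n / 2" .
  qed
  ultimately show ?thesis by blast
qed

theorem theorem7:
  shows "\<exists>e. \<forall>f \<Psi>. usco f \<and> usco_modulus f \<Psi> \<longrightarrow>
           (\<exists>x \<in> continuity_points f.
              \<forall>F G. represents_fun F f \<and> represents_fun_nat G \<Psi> \<longrightarrow>
                computes_real e [F, G, exists2] x)"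
proof -
  obtain e where e: "\<And>F G xs. length xs = Suc 0 \<Longrightarrow>
      kleene e xs [] [F, G, exists2] (path_approximation (step_formula F G) (hd xs))"
    using computable_path_approximation by (rule computableE) blast
  show ?thesis
  proof (intro exI[of _ e] allI impI, elim conjE)
    fix f \<Psi> assume "usco f" "usco_modulus f \<Psi>"
    then obtain x where x: "x \<in> continuity_points f"
        "represents_real (path_approximation (good_step f \<Psi>)) x"
      using usco_continuity_point by blast
    show "\<exists>x \<in> continuity_points f. \<forall>F G. represents_fun F f \<and> represents_fun_nat G \<Psi> \<longrightarrow>
        computes_real e [F, G, exists2] x"
    proof (intro bexI[OF _ x(1)] allI impI, elim conjE)
      fix F G assume "represents_fun F f" "represents_fun_nat G \<Psi>"
      \<comment> \<open>After this rewriting the computed sequence no longer mentions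
        \<open>F\<close> and \<open>G\<close>, so one \<open>x\<close> serves all
        representations.\<close>
      then have "step_formula F G = good_step f \<Psi>" by (rule step_formula_eq_good_step)
      then have "kleene e [n] [] [F, G, exists2] (path_approximation (good_step f \<Psi>) n)" for n
        using e[of "[n]" F G] by simp
      with x(2) show "computes_real e [F, G, exists2] x"
        unfolding computes_real_def by blast
    qed
  qed
qed

end
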